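(* Let $A \in \mathbb{R}^{m\times m}$ be symmetric positive definite, let $y \in \mathbb{R}^m$ be nonzero, let $\Omega \in \mathbb{R}^{m\times n_\Omega}$, and let $k \ge 1$ be an integer. Let $W_k$ be the orthonormal basis of $\mathcal{K}_k(A,y)$ computed by the Lanczos method and $T_k = W_k^{\top}AW_k$. Let $\widehat{W}_k$ be the orthonormal basis of the augmented Krylov subspace $\mathcal{K}_k(A,[y,\Omega])$ computed by the block Lanczos method and $\widehat{T}_k = \widehat{W}_k^{\top}A\widehat{W}_k$. (In particular, the first columns of $W_k$ and of $\widehat{W}_k$ are both $y/\lVert y\rVert_2$.) Then $$0 \le y^{\top}A^{-1}y - \lVert y\rVert_2^2\,(\widehat{T}_k^{-1})_{11} \le y^{\top}A^{-1}y - \lVert y\rVert_2^2\,(T_k^{-1})_{11}.$$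
   Context: For a matrix or vector $Z$ with $m$ rows, $\mathcal{K}_k(A,Z)$ denotes the (block) Krylov subspace, i.e. the span of all columns of $Z, AZ, \dots, A^{k-1}Z$; thus $\mathcal{K}_k(A,[y,\Omega]) = \mathcal{K}_k(A,y)+\mathcal{K}_k(A,\Omega)$. The (block) Lanczos method successively orthonormalizes the blocks $Z, AZ, \dots, A^{k-1}Z$, starting with a QR factorization of $Z$; the resulting matrix has orthonormal columns that form a basis of $\mathcal{K}_k(A,Z)$, and when the first column of $Z$ is $y$ its first column is $y/\lVert y\rVert_2$. Standing assumption: the block size remains constant, i.e. the columns of $[y,\Omega], A[y,\Omega], \dots, A^{k-1}[y,\Omega]$ are linearly independent. $(M)_{11}$ denotes the top left entry of a matrix $M$. *)

theory Defs
  imports Complex_Main "Jordan_Normal_Form.Gauss_Jordan_Elimination" "Jordan_Normal_Form.VS_Connect"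
begin

definition sym_pos_def :: "real mat \<Rightarrow> bool" where
  "sym_pos_def A \<longleftrightarrow> square_mat A \<and> A\<^sup>T = A \<and>
     (\<forall>x \<in> carrier_vec (dim_row A). x \<noteq> 0\<^sub>v (dim_row A) \<longrightarrow> 0 < x \<bullet> (A *\<^sub>v x))"

definition l2_norm :: "real vec \<Rightarrow> real" where
  "l2_norm v = sqrt (v \<bullet> v)"

(* Only meaningful for invertible matrices. *)
abbreviation mat_inv :: "real mat \<Rightarrow> real mat" where
  "mat_inv M \<equiv> the (mat_inverse M)"

definition lin_indep_cols :: "real mat \<Rightarrow> bool" where
  "lin_indep_cols M \<longleftrightarrow> distinct (cols M) \<and>
     module.lin_indpt class_ring (module_vec TYPE(real) (dim_row M)) (set (cols M))"

(* The block row [Z, A Z, ..., A^(k-1) Z]; the span of its columns is the Krylov subspace K_k(A,Z). *)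
definition krylov_matrix :: "real mat \<Rightarrow> real mat \<Rightarrow> nat \<Rightarrow> real mat" where
  "krylov_matrix A Z k = mat (dim_row Z) (k * dim_col Z)
     (\<lambda>(i, c). (A ^\<^sub>m (c div dim_col Z) * Z) $$ (i, c mod dim_col Z))"

(* Columns a, ..., a + n - 1 of M. *)
definition col_range :: "'a mat \<Rightarrow> nat \<Rightarrow> nat \<Rightarrow> 'a mat" where
  "col_range M a n = mat (dim_row M) n (\<lambda>(i, j). M $$ (i, a + j))"

(* Thin QR factorization. The signs of the diagonal of R are not fixed here. *)
definition qr_factorization :: "real mat \<Rightarrow> real mat \<Rightarrow> real mat \<Rightarrow> bool" where
  "qr_factorization X Q R \<longleftrightarrow>
     Q \<in> carrier_mat (dim_row X) (dim_col X) \<and> R \<in> carrier_mat (dim_col X) (dim_col X) \<and>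
     Q\<^sup>T * Q = 1\<^sub>m (dim_col X) \<and> upper_triangular R \<and> X = Q * R"

(* W = [Q_0, ..., Q_(k-1)], where Q_j R_j is a QR factorization of what remains of A^j Z after
   orthogonalization against V = [Q_0, ..., Q_(j-1)]. For j = 0 the matrix V has no columns and
   Q_0 R_0 is a QR factorization of Z itself. The last condition normalizes the first column of W
   to z / ||z||, where z is the first column of Z; all other signs are left open, so that every
   sign convention for the QR factorizations is covered. *)
definition block_lanczos_basis :: "real mat \<Rightarrow> real mat \<Rightarrow> nat \<Rightarrow> real mat \<Rightarrow> bool" where
  "block_lanczos_basis A Z k W \<longleftrightarrow>
     W \<in> carrier_mat (dim_row Z) (k * dim_col Z) \<and>
     (\<exists>R :: nat \<Rightarrow> real mat.
        (\<forall>j < k.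
           let V = col_range W 0 (j * dim_col Z);
               X = A ^\<^sub>m j * Z
           in qr_factorization (X - V * (V\<^sup>T * X)) (col_range W (j * dim_col Z) (dim_col Z)) (R j)) \<and>
        0 < R 0 $$ (0, 0))"

end

theory Submission
  imports Defs "Jordan_Normal_Form.DL_Rank"
begin

text \<open>
  Both quantities subtracted from \<open>y\<^sup>T A\<inverse> y\<close> are energies of Galerkin approximations. For a subspace
  \<open>S\<close>, let \<open>x \<in> S\<close> be the solution of \<open>A x = y\<close> tested against \<open>S\<close> only, that is
  \<open>z\<^sup>T A x = z\<^sup>T y\<close> for all \<open>z \<in> S\<close>. Equivalently, \<open>x\<close> is the orthogonal projection of
  \<open>A\<inverse> y\<close> onto \<open>S\<close> in the inner product given by \<open>A\<close>, and \<open>y\<^sup>T x = x\<^sup>T A x\<close> is the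
  squared length of this projection. It can only grow when \<open>S\<close> grows, which is
  \<open>galerkin_mono\<close>.

  If \<open>S\<close> is spanned by a matrix \<open>W\<close> with orthonormal columns, the first of which is parallel to
  \<open>y\<close>, then \<open>x = W T\<inverse> W\<^sup>T y\<close> with \<open>T = W\<^sup>T A W\<close>, and since \<open>W\<^sup>T y\<close> is
  \<open>\<parallel>y\<parallel>\<close> times a signed first unit vector, \<open>y\<^sup>T x\<close> is \<open>\<parallel>y\<parallel>\<^sup>2\<close> times the top
  left entry of \<open>T\<inverse>\<close>; this is \<open>galerkin_orthonormal_basis\<close>. On the whole space the
  Galerkin solution is \<open>A\<inverse> y\<close> itself. Hence both inequalities are instances of monotonicity,
  for the chain of subspaces consisting of the Krylov space of \<open>y\<close>, the augmented Krylov space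
  and the whole space.

  It remains to see that the Lanczos bases are orthonormal and span the Krylov spaces. This is
  block Gram-Schmidt orthonormalization (\<open>block_gram_schmidt\<close>). The point that needs an argument
  is that the triangular factors are invertible: a kernel vector of such a factor would express a
  combination of the new block by earlier columns, against linear independence.
\<close>

section \<open>Column spans and full column rank\<close>

definition col_span :: "real mat \<Rightarrow> real vec set" where
  "col_span M = (\<lambda>u. M *\<^sub>v u) ` carrier_vec (dim_col M)"

definition full_col_rank :: "real mat \<Rightarrow> bool" where
  "full_col_rank M \<longleftrightarrow>
     (\<forall>u \<in> carrier_vec (dim_col M). M *\<^sub>v u = 0\<^sub>v (dim_row M) \<longrightarrow> u = 0\<^sub>v (dim_col M))"

lemma col_span_carrier: "M \<in> carrier_mat m n \<Longrightarrow> v \<in> col_span M \<Longrightarrow> v \<in> carrier_vec m"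
  unfolding col_span_def by auto

lemma mult_in_col_span:
  "M \<in> carrier_mat m n \<Longrightarrow> u \<in> carrier_vec n \<Longrightarrow> M *\<^sub>v u \<in> col_span M"
  unfolding col_span_def by auto

lemma col_spanE:
  assumes "v \<in> col_span M" "M \<in> carrier_mat m n"
  obtains u where "u \<in> carrier_vec n" "v = M *\<^sub>v u"
  using assms unfolding col_span_def by auto

lemma full_col_rankD:
  "full_col_rank M \<Longrightarrow> M \<in> carrier_mat m n \<Longrightarrow> u \<in> carrier_vec n \<Longrightarrow> M *\<^sub>v u = 0\<^sub>v m
    \<Longrightarrow> u = 0\<^sub>v n"
  unfolding full_col_rank_def by auto

lemma lin_indep_cols_imp_full_col_rank:
  assumes "lin_indep_cols M"
  shows "full_col_rank M"
proof -
  interpret vec_space "TYPE(real)" "dim_row M" .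
  show ?thesis unfolding full_col_rank_def
  proof (intro ballI impI, rule ccontr)
    fix u assume u: "u \<in> carrier_vec (dim_col M)" "M *\<^sub>v u = 0\<^sub>v (dim_row M)"
      and nz: "u \<noteq> 0\<^sub>v (dim_col M)"
    have "lin_dep (set (cols M))"
      by (rule lin_depI[OF _ u(1) nz u(2)]) (use assms in \<open>auto simp: lin_indep_cols_def\<close>)
    then show False using assms unfolding lin_indep_cols_def by simp
  qed
qed

lemma full_col_rank_square_inverse:
  assumes M: "M \<in> carrier_mat n n" and "full_col_rank M"
  obtains B where "mat_inverse M = Some B" "B \<in> carrier_mat n n" "M * B = 1\<^sub>m n" "B * M = 1\<^sub>m n"
proof -
  have "det M \<noteq> 0"
    using det_0_iff_vec_prod_zero[OF M] full_col_rankD[OF assms(2) M] by blast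
  then have "mat_inverse M \<noteq> None"
    using det_non_zero_imp_unit[OF M, of "()"] mat_inverse(1)[OF M, of "()"] by blast
  then obtain B where "mat_inverse M = Some B" by blast
  with mat_inverse(2)[OF M this] that show ?thesis by blast
qed

section \<open>Selecting columns\<close>

text \<open>
  Choosing distinct columns of \<open>M\<close> amounts to multiplying \<open>M\<close> from the right by a 0-1 matrix
  \<open>P\<close> with orthonormal columns. The factorization \<open>N = M P\<close> gives the inclusion of spans, and
  \<open>P\<^sup>T P = 1\<close> shows that the kernel of \<open>N\<close> is trivial if that of \<open>M\<close> is.
\<close>

lemma column_selection:
  assumes N: "N \<in> carrier_mat m n" and M: "M \<in> carrier_mat m l"
    and inj: "inj_on f {..<n}" and f: "\<And>j. j < n \<Longrightarrow> f j < l"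
    and NM: "\<And>i j. i < m \<Longrightarrow> j < n \<Longrightarrow> N $$ (i, j) = M $$ (i, f j)"
  shows column_selection_col_span: "col_span N \<subseteq> col_span M"
    and column_selection_full_col_rank: "full_col_rank M \<Longrightarrow> full_col_rank N"
proof -
  define P where "P = mat l n (\<lambda>(c, j). if c = f j then 1 else (0 :: real))"
  have P: "P \<in> carrier_mat l n" unfolding P_def by simp
  have N_eq: "N = M * P"
  proof (rule eq_matI)
    fix i j assume "i < dim_row (M * P)" "j < dim_col (M * P)"
    then have ij: "i < m" "j < n" using M P by auto
    have "(M * P) $$ (i, j) = (\<Sum>c = 0..<l. M $$ (i, c) * (if c = f j then 1 else 0))"
      using ij M by (simp add: P_def scalar_prod_def)
    also have "\<dots> = M $$ (i, f j)" using f[OF ij(2)] by (simp add: if_distrib sum.delta cong: if_cong)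
    finally show "N $$ (i, j) = (M * P) $$ (i, j)" using NM ij by simp
  qed (use N M P in auto)
  have PP: "P\<^sup>T * P = 1\<^sub>m n"
  proof (rule eq_matI)
    fix i j assume "i < dim_row (1\<^sub>m n :: real mat)" "j < dim_col (1\<^sub>m n :: real mat)"
    then have ij: "i < n" "j < n" by auto
    have "(P\<^sup>T * P) $$ (i, j)
        = (\<Sum>c = 0..<l. (if c = f i then 1 else 0) * (if c = f j then 1 else 0))"
      using ij by (simp add: P_def scalar_prod_def)
    also have "\<dots> = (if f i = f j then 1 else 0)"
      using f[OF ij(1)] by (simp add: if_distrib sum.delta cong: if_cong)
    also have "\<dots> = (if i = j then 1 else 0)" using inj ij by (auto dest: inj_onD)
    finally show "(P\<^sup>T * P) $$ (i, j) = 1\<^sub>m n $$ (i, j)" using ij by simp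
  qed (use P in auto)
  have Nu: "N *\<^sub>v u = M *\<^sub>v (P *\<^sub>v u)" if "u \<in> carrier_vec n" for u
    using N_eq M P that by simp
  show "col_span N \<subseteq> col_span M"
  proof
    fix v assume "v \<in> col_span N"
    then obtain u where "u \<in> carrier_vec n" "v = N *\<^sub>v u" using N by (rule col_spanE)
    then show "v \<in> col_span M" using Nu mult_in_col_span[OF M, of "P *\<^sub>v u"] P by simp
  qed
  show "full_col_rank N" if rk: "full_col_rank M"
    unfolding full_col_rank_def
  proof (intro ballI impI)
    fix u assume "u \<in> carrier_vec (dim_col N)" and z: "N *\<^sub>v u = 0\<^sub>v (dim_row N)"
    then have u: "u \<in> carrier_vec n" using N by simp
    have "P *\<^sub>v u = 0\<^sub>v l"
      using full_col_rankD[OF rk M, of "P *\<^sub>v u"] Nu[OF u] z N P u by simp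
    have "u = (P\<^sup>T * P) *\<^sub>v u" using u PP by simp
    also have "\<dots> = P\<^sup>T *\<^sub>v (P *\<^sub>v u)"
      by (rule assoc_mult_mat_vec[of _ n l _ n]) (use u P in auto)
    also have "\<dots> = 0\<^sub>v n" unfolding \<open>P *\<^sub>v u = 0\<^sub>v l\<close> using P by (intro eq_vecI) auto
    finally show "u = 0\<^sub>v (dim_col N)" using N by simp
  qed
qed

lemma col_range_carrier [simp]: "M \<in> carrier_mat m l \<Longrightarrow> col_range M a n \<in> carrier_mat m n"
  unfolding col_range_def by simp

lemma col_range_all: "M \<in> carrier_mat m l \<Longrightarrow> col_range M 0 l = M"
  unfolding col_range_def by (rule eq_matI) auto

lemma col_range_full_col_rank:
  assumes M: "M \<in> carrier_mat m l" and "full_col_rank M" and "a + n \<le> l"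
  shows "full_col_rank (col_range M a n)"
  by (rule column_selection_full_col_rank[OF col_range_carrier[OF M] M, of "\<lambda>j. a + j"])
    (use assms in \<open>auto simp: col_range_def\<close>)

lemma col_range_mult_append:
  assumes M: "M \<in> carrier_mat m l" and u: "u \<in> carrier_vec a" and w: "w \<in> carrier_vec n"
    and l: "a + n \<le> l"
  shows "col_range M 0 (a + n) *\<^sub>v (u @\<^sub>v w) = col_range M 0 a *\<^sub>v u + col_range M a n *\<^sub>v w"
proof (rule eq_vecI)
  fix i assume "i < dim_vec (col_range M 0 a *\<^sub>v u + col_range M a n *\<^sub>v w)"
  then have i: "i < m" using M by (simp add: col_range_def)
  have "row (col_range M 0 (a + n)) i = row (col_range M 0 a) i @\<^sub>v row (col_range M a n) i"
    using M i by (intro eq_vecI) (auto simp: col_range_def)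
  then show "(col_range M 0 (a + n) *\<^sub>v (u @\<^sub>v w)) $ i
      = (col_range M 0 a *\<^sub>v u + col_range M a n *\<^sub>v w) $ i"
    using i M u w scalar_prod_append[of "row (col_range M 0 a) i" a "row (col_range M a n) i" n u w]
    by (simp add: col_range_def)
qed (use M in \<open>simp add: col_range_def\<close>)

lemma col_span_col_range_iff:
  assumes M: "M \<in> carrier_mat m l" and l: "a + n \<le> l"
  shows "v \<in> col_span (col_range M 0 (a + n)) \<longleftrightarrow>
    (\<exists>u \<in> carrier_vec a. \<exists>w \<in> carrier_vec n. v = col_range M 0 a *\<^sub>v u + col_range M a n *\<^sub>v w)"
    (is "?L \<longleftrightarrow> ?R")
proof
  assume ?L
  then obtain x where x: "x \<in> carrier_vec (a + n)" "v = col_range M 0 (a + n) *\<^sub>v x"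
    using col_range_carrier[OF M] by (rule col_spanE)
  have "x = vec_first x a @\<^sub>v vec_last x n" using x(1) by simp
  with x(2) have "v = col_range M 0 a *\<^sub>v vec_first x a + col_range M a n *\<^sub>v vec_last x n"
    using col_range_mult_append[OF M _ _ l, of "vec_first x a" "vec_last x n"] by simp
  then show ?R using vec_first_carrier[of x a] vec_last_carrier[of x n] by blast
next
  assume ?R
  then show ?L
    using col_range_mult_append[OF M _ _ l] mult_in_col_span[OF col_range_carrier[OF M]]
    by (metis append_carrier_vec)
qed

section \<open>Block Gram-Schmidt orthonormalization\<close>

text \<open>
  Every entry of each of the Gram matrices is an inner product of two columns of \<open>W\<close>, so the
  three hypotheses together supply all the inner products needed.
\<close>

lemma orthonormal_append:
  fixes W :: "real mat"
  assumes W: "W \<in> carrier_mat m l" and l: "a + n \<le> l"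
    and VV: "(col_range W 0 a)\<^sup>T * col_range W 0 a = 1\<^sub>m a"
    and QQ: "(col_range W a n)\<^sup>T * col_range W a n = 1\<^sub>m n"
    and VQ: "(col_range W 0 a)\<^sup>T * col_range W a n = 0\<^sub>m a n"
  shows "(col_range W 0 (a + n))\<^sup>T * col_range W 0 (a + n) = 1\<^sub>m (a + n)"
proof -
  let ?M = "col_range W 0 (a + n)"
  have gram: "((col_range W b p)\<^sup>T * col_range W c q) $$ (i, j)
      = (\<Sum>r = 0..<m. W $$ (r, b + i) * W $$ (r, c + j))" if "i < p" "j < q" for b p c q i j
    using that W by (simp add: col_range_def scalar_prod_def)
  have vv: "(\<Sum>r = 0..<m. W $$ (r, i) * W $$ (r, j)) = (if i = j then 1 else 0)"
    if "i < a" "j < a" for i j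
    using gram[of i a j a 0 0] that VV by simp
  have vq: "(\<Sum>r = 0..<m. W $$ (r, i) * W $$ (r, j)) = 0"
    if "i < a" "a \<le> j" "j < a + n" for i j
    using gram[of i a "j - a" n 0 a] that VQ by simp
  have qq: "(\<Sum>r = 0..<m. W $$ (r, i) * W $$ (r, j)) = (if i = j then 1 else 0)"
    if "a \<le> i" "i < a + n" "a \<le> j" "j < a + n" for i j
  proof -
    have "i - a = j - a \<longleftrightarrow> i = j" using that by auto
    then show ?thesis using gram[of "i - a" n "j - a" n a a] that QQ by simp
  qed
  show ?thesis
  proof (rule eq_matI)
    fix i j assume "i < dim_row (1\<^sub>m (a + n) :: real mat)" "j < dim_col (1\<^sub>m (a + n) :: real mat)"
    then have ij: "i < a + n" "j < a + n" by auto
    have "(\<Sum>r = 0..<m. W $$ (r, i) * W $$ (r, j)) = (if i = j then 1 else 0)"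
    proof (cases "i < a"; cases "j < a")
      assume "\<not> i < a" "j < a"
      then have "(\<Sum>r = 0..<m. W $$ (r, j) * W $$ (r, i)) = 0" using vq[of j i] ij by simp
      then show ?thesis using \<open>\<not> i < a\<close> \<open>j < a\<close> by (auto simp: mult.commute)
    qed (use vv vq qq ij in auto)
    then show "(?M\<^sup>T * ?M) $$ (i, j) = 1\<^sub>m (a + n) $$ (i, j)"
      using gram[of i "a + n" j "a + n" 0 0] ij by simp
  qed (use W in \<open>auto simp: col_range_def\<close>)
qed

text \<open>
  Write \<open>V\<close> for the basis built so far, \<open>X\<close> for the new block and \<open>C = V\<^sup>T X\<close>, so that
  \<open>X = V C + Q R\<close>. By itself a QR factorization of a rank deficient remainder leaves some columns
  of \<open>Q\<close> arbitrary, and \<open>Q\<close> need then be neither orthogonal to \<open>V\<close> nor inside the span of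
  \<open>K\<close>. Full column rank of \<open>K\<close> excludes this: \<open>R u = 0\<close> gives \<open>X u = V C u\<close>, which lies in the
  span of the earlier columns of \<open>K\<close>, so \<open>u = 0\<close>. With \<open>R\<close> invertible, \<open>V\<^sup>T Q R = C - C = 0\<close>
  yields \<open>V\<^sup>T Q = 0\<close>, and \<open>X = V C + Q R\<close> can be solved for \<open>Q\<close>, so the spans agree.
\<close>

lemma gram_schmidt_step:
  assumes W: "W \<in> carrier_mat m l" and K: "K \<in> carrier_mat m l" and l: "a + n \<le> l"
    and rk: "full_col_rank K"
    and VV: "(col_range W 0 a)\<^sup>T * col_range W 0 a = 1\<^sub>m a"
    and span: "col_span (col_range W 0 a) = col_span (col_range K 0 a)"
    and qr: "qr_factorization
       (col_range K a n - col_range W 0 a * ((col_range W 0 a)\<^sup>T * col_range K a n))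
       (col_range W a n) R"
  shows "(col_range W 0 (a + n))\<^sup>T * col_range W 0 (a + n) = 1\<^sub>m (a + n)"
    and "col_span (col_range W 0 (a + n)) = col_span (col_range K 0 (a + n))"
proof -
  define V where "V = col_range W 0 a"
  define Q where "Q = col_range W a n"
  define X where "X = col_range K a n"
  define C where "C = V\<^sup>T * X"
  have V: "V \<in> carrier_mat m a" and Q: "Q \<in> carrier_mat m n" and X: "X \<in> carrier_mat m n"
    unfolding V_def Q_def X_def using W K by auto
  have Vt: "V\<^sup>T \<in> carrier_mat a m" and C: "C \<in> carrier_mat a n"
    unfolding C_def using V X by auto
  have VC: "V * C \<in> carrier_mat m n" using V C by auto
  have R: "R \<in> carrier_mat n n" and QQ: "Q\<^sup>T * Q = 1\<^sub>m n" and XQR: "X - V * C = Q * R"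
    using qr X V C unfolding qr_factorization_def V_def[symmetric] Q_def[symmetric]
      X_def[symmetric] C_def[symmetric] by auto
  have XQRu: "X *\<^sub>v u = V *\<^sub>v (C *\<^sub>v u) + Q *\<^sub>v (R *\<^sub>v u)" if u: "u \<in> carrier_vec n" for u
  proof -
    have "Q *\<^sub>v (R *\<^sub>v u) = X *\<^sub>v u - V *\<^sub>v (C *\<^sub>v u)"
      using minus_mult_distrib_mat_vec[OF X VC u] XQR u Q R V C by simp
    then show ?thesis using u X V C by (intro eq_vecI) auto
  qed
  have Rrk: "full_col_rank R" unfolding full_col_rank_def
  proof (intro ballI impI)
    fix u assume "u \<in> carrier_vec (dim_col R)" "R *\<^sub>v u = 0\<^sub>v (dim_row R)"
    then have u: "u \<in> carrier_vec n" and Ru: "R *\<^sub>v u = 0\<^sub>v n" using R by auto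
    have "Q *\<^sub>v (R *\<^sub>v u) = 0\<^sub>v m" unfolding Ru using Q by (intro eq_vecI) auto
    then have Xu: "X *\<^sub>v u = V *\<^sub>v (C *\<^sub>v u)"
      using XQRu[OF u] V C u by simp
    also have "\<dots> \<in> col_span (col_range K 0 a)"
      using mult_in_col_span[OF V, of "C *\<^sub>v u"] C u span unfolding V_def[symmetric] by simp
    finally obtain w where w: "w \<in> carrier_vec a" "X *\<^sub>v u = col_range K 0 a *\<^sub>v w"
      using col_range_carrier[OF K] by (rule col_spanE)
    \<comment> \<open>The dependence \<open>X u = K w\<close> between the new and the earlier columns is a kernel vector.\<close>
    have "col_range K 0 (a + n) *\<^sub>v (w @\<^sub>v - u) = col_range K 0 a *\<^sub>v w + X *\<^sub>v (- u)"
      using col_range_mult_append[OF K w(1) _ l, of "- u"] u unfolding X_def by simp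
    also have "X *\<^sub>v (- u) = - (X *\<^sub>v u)"
      using u X by (intro eq_vecI) auto
    also have "col_range K 0 a *\<^sub>v w + - (X *\<^sub>v u) = 0\<^sub>v m"
      unfolding w(2)[symmetric] using X u by (intro eq_vecI) auto
    finally have "w @\<^sub>v - u = 0\<^sub>v (a + n)"
      using full_col_rankD[OF col_range_full_col_rank[OF K rk] col_range_carrier[OF K]] w u l
      by (metis append_carrier_vec uminus_carrier_vec add_0)
    then have "(w @\<^sub>v - u) $ (a + i) = 0" if "i < n" for i using that by simp
    then have "u $ i = 0" if "i < n" for i using that w u by fastforce
    then show "u = 0\<^sub>v (dim_col R)" using u R by (intro eq_vecI) auto
  qed
  \<comment> \<open>Right multiplication by \<open>S\<close> cancels \<open>R\<close>, which reduces \<open>V\<^sup>T Q = 0\<close> to \<open>V\<^sup>T (Q R) = 0\<close>.\<close>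
  obtain S where S: "S \<in> carrier_mat n n" "R * S = 1\<^sub>m n"
    using full_col_rank_square_inverse[OF R Rrk] by metis
  have "V\<^sup>T * (Q * R) = C - V\<^sup>T * (V * C)"
    unfolding XQR[symmetric] using mult_minus_distrib_mat[OF Vt X VC] C_def by simp
  also have "V\<^sup>T * (V * C) = V\<^sup>T * V * C"
    using assoc_mult_mat[OF Vt V C] by simp
  also have "V\<^sup>T * V * C = C" using VV C unfolding V_def by simp
  also have "C - C = 0\<^sub>m a n" using C by (intro eq_matI) auto
  finally have VQR: "V\<^sup>T * (Q * R) = 0\<^sub>m a n" .
  have "V\<^sup>T * Q = V\<^sup>T * Q * (R * S)" using S Vt Q by simp
  also have "\<dots> = V\<^sup>T * (Q * R) * S"
    using Vt Q R S(1) by (simp add: assoc_mult_mat[of _ a m _ n _ n] assoc_mult_mat[of _ a n _ n _ n])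
  finally have VQ: "V\<^sup>T * Q = 0\<^sub>m a n" unfolding VQR using S(1) by simp
  show "(col_range W 0 (a + n))\<^sup>T * col_range W 0 (a + n) = 1\<^sub>m (a + n)"
    using orthonormal_append[OF W l VV] QQ VQ unfolding Q_def V_def by simp
  have colspW: "v \<in> col_span (col_range W 0 (a + n)) \<longleftrightarrow>
      (\<exists>u \<in> carrier_vec a. \<exists>w \<in> carrier_vec n. v = V *\<^sub>v u + Q *\<^sub>v w)" for v
    using col_span_col_range_iff[OF W l] unfolding V_def Q_def .
  have colspK: "v \<in> col_span (col_range K 0 (a + n)) \<longleftrightarrow>
      (\<exists>u \<in> carrier_vec a. \<exists>w \<in> carrier_vec n. v = col_range K 0 a *\<^sub>v u + X *\<^sub>v w)" for v
    using col_span_col_range_iff[OF K l] unfolding X_def .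
  show "col_span (col_range W 0 (a + n)) = col_span (col_range K 0 (a + n))"
  proof (intro equalityI subsetI)
    fix v assume "v \<in> col_span (col_range W 0 (a + n))"
    then obtain u w where u: "u \<in> carrier_vec a" and w: "w \<in> carrier_vec n"
      and v: "v = V *\<^sub>v u + Q *\<^sub>v w" using colspW by blast
    define s where "s = S *\<^sub>v w"
    have s: "s \<in> carrier_vec n" using S(1) w unfolding s_def by simp
    have "R *\<^sub>v s = w"
      using assoc_mult_mat_vec[OF R S(1) w] S(2) w unfolding s_def by simp
    then have "v = V *\<^sub>v (u - C *\<^sub>v s) + X *\<^sub>v s"
      using XQRu[OF s] v mult_minus_distrib_mat_vec[OF V u, of "C *\<^sub>v s"] V Q C X s u w
      by (intro eq_vecI) auto
    moreover have "V *\<^sub>v (u - C *\<^sub>v s) \<in> col_span (col_range K 0 a)"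
      using mult_in_col_span[OF V, of "u - C *\<^sub>v s"] u C s span unfolding V_def by simp
    ultimately show "v \<in> col_span (col_range K 0 (a + n))"
      using colspK s col_spanE[OF _ col_range_carrier[OF K]] by metis
  next
    fix v assume "v \<in> col_span (col_range K 0 (a + n))"
    then obtain u w where u: "u \<in> carrier_vec a" and w: "w \<in> carrier_vec n"
      and v: "v = col_range K 0 a *\<^sub>v u + X *\<^sub>v w" using colspK by blast
    obtain u' where u': "u' \<in> carrier_vec a" "col_range K 0 a *\<^sub>v u = V *\<^sub>v u'"
      using mult_in_col_span[OF col_range_carrier[OF K] u] span V unfolding V_def
      by (metis col_spanE)
    have "v = V *\<^sub>v (u' + C *\<^sub>v w) + Q *\<^sub>v (R *\<^sub>v w)"
      unfolding v u'(2) XQRu[OF w]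
      using mult_add_distrib_mat_vec[OF V u'(1), of "C *\<^sub>v w"] V Q C R u'(1) w
      by (intro eq_vecI) auto
    moreover have "u' + C *\<^sub>v w \<in> carrier_vec a" "R *\<^sub>v w \<in> carrier_vec n"
      using u' C R w by auto
    ultimately show "v \<in> col_span (col_range W 0 (a + n))" using colspW by blast
  qed
qed

text \<open>
  Orthonormality and equality of spans are carried through one induction over the blocks, because
  each step uses both for the preceding columns.
\<close>

lemma block_gram_schmidt:
  assumes W: "W \<in> carrier_mat m (k * d)" and K: "K \<in> carrier_mat m (k * d)"
    and rk: "full_col_rank K"
    and qr: "\<And>j. j < k \<Longrightarrow> qr_factorization
       (col_range K (j * d) d
          - col_range W 0 (j * d) * ((col_range W 0 (j * d))\<^sup>T * col_range K (j * d) d))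
       (col_range W (j * d) d) (R j)"
  shows "W\<^sup>T * W = 1\<^sub>m (k * d)" and "col_span W = col_span K"
proof -
  have "(col_range W 0 (j * d))\<^sup>T * col_range W 0 (j * d) = 1\<^sub>m (j * d) \<and>
      col_span (col_range W 0 (j * d)) = col_span (col_range K 0 (j * d))" if "j \<le> k" for j
    using that
  proof (induction j)
    case 0
    \<comment> \<open>A matrix without columns spans the zero space, not the empty set.\<close>
    have "(\<lambda>u. M *\<^sub>v u) ` carrier_vec 0 = {0\<^sub>v m}" if "M \<in> carrier_mat m 0" for M :: "real mat"
      using that by (auto intro!: eq_vecI image_eqI[of _ _ "0\<^sub>v 0"] simp: scalar_prod_def)
    then have "col_span M = {0\<^sub>v m}" if "M \<in> carrier_mat m 0" for M
      using that unfolding col_span_def by auto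
    then have "col_span (col_range W 0 0) = col_span (col_range K 0 0)"
      using col_range_carrier W K by metis
    moreover have "(col_range W 0 0)\<^sup>T * col_range W 0 0 = 1\<^sub>m 0"
      by (rule eq_matI) (auto simp: col_range_def)
    ultimately show ?case by simp
  next
    case (Suc j)
    then have j: "j < k" by simp
    have l: "j * d + d \<le> k * d" using mult_le_mono1[of "Suc j" k d] j by simp
    show ?case
      using gram_schmidt_step[OF W K l rk _ _ qr[OF j]] Suc.IH j by (simp add: add.commute)
  qed
  from this[of k] show "W\<^sup>T * W = 1\<^sub>m (k * d)" "col_span W = col_span K"
    using col_range_all[OF W] col_range_all[OF K] by auto
qed

section \<open>Krylov matrices and the block Lanczos basis\<close>

lemma krylov_matrix_carrier: "Z \<in> carrier_mat m d \<Longrightarrow> krylov_matrix A Z k \<in> carrier_mat m (k * d)"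
  unfolding krylov_matrix_def by simp

lemma col_range_krylov_matrix:
  assumes A: "A \<in> carrier_mat m m" and Z: "Z \<in> carrier_mat m d" and j: "j < k"
  shows "col_range (krylov_matrix A Z k) (j * d) d = A ^\<^sub>m j * Z"
proof (rule eq_matI)
  fix i c assume "i < dim_row (A ^\<^sub>m j * Z)" "c < dim_col (A ^\<^sub>m j * Z)"
  then have ic: "i < m" "c < d" using A Z by auto
  have "j * d + c < k * d"
    using mult_le_mono1[of "Suc j" k d] j ic(2) by simp
  moreover have "(j * d + c) div d = j" "(j * d + c) mod d = c" using ic(2) by auto
  ultimately show "col_range (krylov_matrix A Z k) (j * d) d $$ (i, c) = (A ^\<^sub>m j * Z) $$ (i, c)"
    using ic Z by (simp add: col_range_def krylov_matrix_def)
qed (use A Z in \<open>auto simp: col_range_def krylov_matrix_def\<close>)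

text \<open>
  The column \<open>A\<^sup>j y\<close> of the Krylov matrix of \<open>y\<close> is the first column of the block \<open>A\<^sup>j Z\<close>,
  i.e. column \<open>j * d\<close> of the block Krylov matrix. Thus the unaugmented Krylov space is contained
  in the augmented one and inherits linear independence of its generators.
\<close>

lemma krylov_matrix_first_column:
  fixes k :: nat
  assumes A: "A \<in> carrier_mat m m" and y: "y \<in> carrier_vec m"
    and Z: "Z \<in> carrier_mat m d" and d: "0 < d" and y0: "col Z 0 = y"
  defines "Ky \<equiv> krylov_matrix A (mat_of_cols m [y]) k" and "KZ \<equiv> krylov_matrix A Z k"
  shows "col_span Ky \<subseteq> col_span KZ" and "full_col_rank KZ \<Longrightarrow> full_col_rank Ky"
proof -
  have y1: "mat_of_cols m [y] \<in> carrier_mat m 1"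
    using mat_of_cols_carrier(1)[of m "[y]"] by simp
  have colsel: "Ky $$ (i, j) = KZ $$ (i, j * d)" if "i < m" "j < k" for i j
  proof -
    have "col (mat_of_cols m [y]) 0 = col Z 0" using y y0 by simp
    moreover have "j * d < k * d" using that d by simp
    ultimately show ?thesis
      using that d A Z y1 unfolding Ky_def KZ_def krylov_matrix_def by simp
  qed
  have inj: "inj_on (\<lambda>j. j * d) {..<k}" using d by (auto intro!: inj_onI)
  have Kyc: "Ky \<in> carrier_mat m k" and KZc: "KZ \<in> carrier_mat m (k * d)"
    unfolding Ky_def KZ_def using krylov_matrix_carrier[OF y1] krylov_matrix_carrier[OF Z] by auto
  show "col_span Ky \<subseteq> col_span KZ"
    by (rule column_selection_col_span[OF Kyc KZc inj]) (use d colsel in auto)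
  show "full_col_rank KZ \<Longrightarrow> full_col_rank Ky"
    by (rule column_selection_full_col_rank[OF Kyc KZc inj]) (use d colsel in auto)
qed

lemma block_lanczos_basis_krylov:
  assumes A: "A \<in> carrier_mat m m" and Z: "Z \<in> carrier_mat m d"
    and W: "block_lanczos_basis A Z k W" and rk: "full_col_rank (krylov_matrix A Z k)"
  shows "W\<^sup>T * W = 1\<^sub>m (k * d)" and "col_span W = col_span (krylov_matrix A Z k)"
proof -
  from W obtain R where Wc: "W \<in> carrier_mat m (k * d)" and qr: "\<forall>j < k. qr_factorization
      (A ^\<^sub>m j * Z - col_range W 0 (j * d) * ((col_range W 0 (j * d))\<^sup>T * (A ^\<^sub>m j * Z)))
      (col_range W (j * d) d) (R j)"
    using Z unfolding block_lanczos_basis_def Let_def by auto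
  note gs = block_gram_schmidt[OF Wc krylov_matrix_carrier[OF Z] rk, of R]
  have "qr_factorization
       (col_range (krylov_matrix A Z k) (j * d) d
          - col_range W 0 (j * d) * ((col_range W 0 (j * d))\<^sup>T * col_range (krylov_matrix A Z k) (j * d) d))
       (col_range W (j * d) d) (R j)" if "j < k" for j
    using qr that col_range_krylov_matrix[OF A Z that] by simp
  then show "W\<^sup>T * W = 1\<^sub>m (k * d)" and "col_span W = col_span (krylov_matrix A Z k)"
    using gs by blast+
qed

text \<open>
  There is nothing to orthogonalize the block \<open>A\<^sup>0 Z = Z\<close> against, so \<open>Z = Q R\<close>. As \<open>R\<close> is
  upper triangular, its first column vanishes below the diagonal, and \<open>r\<close> is its diagonal entry.
\<close>

lemma block_lanczos_basis_first_column:
  assumes A: "A \<in> carrier_mat m m" and Z: "Z \<in> carrier_mat m d" and d: "0 < d" and k: "1 \<le> k"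
    and W: "block_lanczos_basis A Z k W"
  obtains r where "col Z 0 = r \<cdot>\<^sub>v col W 0"
proof -
  from W Z obtain R where Wc: "W \<in> carrier_mat m (k * d)" and qr: "qr_factorization
      (A ^\<^sub>m 0 * Z - col_range W 0 (0 * d) * ((col_range W 0 (0 * d))\<^sup>T * (A ^\<^sub>m 0 * Z)))
      (col_range W (0 * d) d) (R 0)"
    using k unfolding block_lanczos_basis_def Let_def by fastforce
  have "A ^\<^sub>m 0 * Z - col_range W 0 (0 * d) * ((col_range W 0 (0 * d))\<^sup>T * (A ^\<^sub>m 0 * Z)) = Z"
    using A Z Wc by (intro eq_matI) (auto simp: col_range_def scalar_prod_def)
  with qr Z have R: "R 0 \<in> carrier_mat d d" "upper_triangular (R 0)"
    and ZQR: "Z = col_range W 0 d * R 0"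
    unfolding qr_factorization_def by auto
  have dk: "d \<le> k * d" using k by simp
  have "col Z 0 = R 0 $$ (0, 0) \<cdot>\<^sub>v col W 0"
  proof (rule eq_vecI)
    fix i assume "i < dim_vec (R 0 $$ (0, 0) \<cdot>\<^sub>v col W 0)"
    then have i: "i < m" using Wc by simp
    have "col Z 0 $ i = Z $$ (i, 0)" using Z i d by simp
    also have "\<dots> = (col_range W 0 d * R 0) $$ (i, 0)" using ZQR by simp
    also have "\<dots> = (\<Sum>l = 0..<d. W $$ (i, l) * R 0 $$ (l, 0))"
      using i d Wc R(1) by (simp add: col_range_def scalar_prod_def)
    also have "\<dots> = (\<Sum>l = 0..<d. if l = 0 then W $$ (i, 0) * R 0 $$ (0, 0) else 0)"
      by (rule sum.cong) (use R in \<open>auto simp: upper_triangular_def\<close>)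
    also have "\<dots> = (R 0 $$ (0, 0) \<cdot>\<^sub>v col W 0) $ i"
      using d i Wc dk by simp
    finally show "col Z 0 $ i = (R 0 $$ (0, 0) \<cdot>\<^sub>v col W 0) $ i" .
  qed (use Z Wc in simp)
  then show ?thesis by (rule that)
qed

section \<open>Galerkin approximations\<close>

text \<open>
  The Galerkin condition is the linear system \<open>A x = y\<close> restricted to trial and test vectors
  from \<open>S\<close>. Stating it for sets of vectors, without a chosen basis, allows solutions from
  different bases to be compared.
\<close>

definition galerkin :: "real mat \<Rightarrow> real vec \<Rightarrow> real vec set \<Rightarrow> real vec \<Rightarrow> bool" where
  "galerkin A y S x \<longleftrightarrow> x \<in> S \<and> (\<forall>z \<in> S. z \<bullet> (A *\<^sub>v x) = z \<bullet> y)"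

text \<open>
  A kernel vector \<open>u\<close> of \<open>W\<^sup>T A W\<close> satisfies \<open>(W u)\<^sup>T A (W u) = 0\<close>, hence \<open>W u = 0\<close> by
  definiteness. So the projected matrix is invertible; \<open>W = 1\<close> covers \<open>A\<close> itself.
\<close>

lemma sym_pos_def_full_col_rank:
  assumes A: "A \<in> carrier_mat m m" and spd: "sym_pos_def A" and W: "W \<in> carrier_mat m n"
    and rk: "full_col_rank W"
  shows "full_col_rank (W\<^sup>T * A * W)"
  unfolding full_col_rank_def
proof (intro ballI impI)
  fix u assume "u \<in> carrier_vec (dim_col (W\<^sup>T * A * W))"
    and z: "W\<^sup>T * A * W *\<^sub>v u = 0\<^sub>v (dim_row (W\<^sup>T * A * W))"
  then have u: "u \<in> carrier_vec n" using W by simp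
  have "W\<^sup>T * A * W *\<^sub>v u = W\<^sup>T *\<^sub>v (A *\<^sub>v (W *\<^sub>v u))"
    using A W u by (simp add: assoc_mult_mat_vec[of _ n m _ n] assoc_mult_mat_vec[of _ n m _ m])
  then have "(W\<^sup>T *\<^sub>v (A *\<^sub>v (W *\<^sub>v u))) \<bullet> u = 0"
    using z W scalar_prod_left_zero[OF u] by simp
  then have "(A *\<^sub>v (W *\<^sub>v u)) \<bullet> (W *\<^sub>v u) = 0"
    using transpose_vec_mult_scalar[OF W u, of "A *\<^sub>v (W *\<^sub>v u)"] A W u by simp
  then have "(W *\<^sub>v u) \<bullet> (A *\<^sub>v (W *\<^sub>v u)) = 0"
    using comm_scalar_prod[of "W *\<^sub>v u" m "A *\<^sub>v (W *\<^sub>v u)"] A W u by simp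
  then have "W *\<^sub>v u = 0\<^sub>v m"
    using spd A W u unfolding sym_pos_def_def by (metis carrier_matD(1) less_irrefl mult_mat_vec_carrier)
  then show "u = 0\<^sub>v (dim_col (W\<^sup>T * A * W))" using full_col_rankD[OF rk W u] W by simp
qed

text \<open>
  Because \<open>x\<close> belongs to \<open>S'\<close> as well, it is an admissible test vector for \<open>x'\<close>, so
  \<open>x\<^sup>T A x' = x\<^sup>T y = x\<^sup>T A x\<close>. Expanding \<open>(x' - x)\<^sup>T A (x' - x) \<ge> 0\<close> with this identity leaves
  exactly \<open>y\<^sup>T x' - y\<^sup>T x\<close>.
\<close>

lemma galerkin_mono:
  assumes A: "A \<in> carrier_mat m m" and spd: "sym_pos_def A" and y: "y \<in> carrier_vec m"
    and SS: "S \<subseteq> S'" and S': "S' \<subseteq> carrier_vec m"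
    and x: "galerkin A y S x" and x': "galerkin A y S' x'"
  shows "y \<bullet> x \<le> y \<bullet> x'"
proof -
  have c: "x \<in> carrier_vec m" "x' \<in> carrier_vec m" and xS: "x \<in> S'"
    using x x' SS S' unfolding galerkin_def by auto
  have Ac: "A *\<^sub>v x \<in> carrier_vec m" "A *\<^sub>v x' \<in> carrier_vec m" using A c by auto
  have "A\<^sup>T = A" using spd unfolding sym_pos_def_def by simp
  then have sym: "x' \<bullet> (A *\<^sub>v x) = x \<bullet> (A *\<^sub>v x')"
    using transpose_vec_mult_scalar[OF A c(1) c(2)] comm_scalar_prod[OF c(1) Ac(2)] by simp
  have e: "x \<bullet> (A *\<^sub>v x) = y \<bullet> x" "x' \<bullet> (A *\<^sub>v x') = y \<bullet> x'" "x \<bullet> (A *\<^sub>v x') = y \<bullet> x"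
    using x x' xS comm_scalar_prod[OF y c(1)] comm_scalar_prod[OF y c(2)]
    unfolding galerkin_def by auto
  have "0 \<le> (x' - x) \<bullet> (A *\<^sub>v (x' - x))"
  proof (cases "x' - x = 0\<^sub>v m")
    case True
    then show ?thesis using A by simp
  next
    case False
    then show ?thesis using spd A c unfolding sym_pos_def_def
      by (metis carrier_matD(1) less_imp_le minus_carrier_vec)
  qed
  also have "\<dots> = x' \<bullet> (A *\<^sub>v x') - x' \<bullet> (A *\<^sub>v x) - (x \<bullet> (A *\<^sub>v x') - x \<bullet> (A *\<^sub>v x))"
    using mult_minus_distrib_mat_vec[OF A c(2) c(1)] c Ac
    by (simp add: minus_scalar_prod_distrib[of _ m] scalar_prod_minus_distrib[of _ m])
  finally show ?thesis using e sym by simp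
qed

text \<open>
  In the coordinates of \<open>W\<close> the Galerkin condition is the system \<open>T c = W\<^sup>T y = r e\<close> with the
  first unit vector \<open>e\<close>. Then \<open>y\<^sup>T x = (W\<^sup>T y)\<^sup>T c = r\<^sup>2 e\<^sup>T T\<inverse> e\<close>, and \<open>r\<^sup>2 = \<parallel>y\<parallel>\<^sup>2\<close> since
  \<open>y\<close> is \<open>r\<close> times a unit vector.
\<close>

lemma galerkin_orthonormal_basis:
  assumes A: "A \<in> carrier_mat m m" and spd: "sym_pos_def A" and W: "W \<in> carrier_mat m n"
    and WW: "W\<^sup>T * W = 1\<^sub>m n" and n: "0 < n" and y: "y = r \<cdot>\<^sub>v col W 0"
  obtains x where "galerkin A y (col_span W) x"
    and "y \<bullet> x = (l2_norm y)\<^sup>2 * mat_inv (W\<^sup>T * A * W) $$ (0, 0)"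
proof -
  let ?T = "W\<^sup>T * A * W" and ?e = "unit_vec n 0 :: real vec"
  have T: "?T \<in> carrier_mat n n" and Wt: "W\<^sup>T \<in> carrier_mat n m" using A W by auto
  have We: "col W 0 = W *\<^sub>v ?e"
    using W n by (intro eq_vecI) auto
  have Wte: "W\<^sup>T *\<^sub>v (W *\<^sub>v u) = u" if "u \<in> carrier_vec n" for u
    using assoc_mult_mat_vec[OF Wt W that] WW that by simp
  have yc: "y \<in> carrier_vec m" using y W by auto
  have Wty: "W\<^sup>T *\<^sub>v y = r \<cdot>\<^sub>v ?e"
    unfolding y We using mult_mat_vec[OF Wt, of "W *\<^sub>v ?e" r] Wte[of ?e] W by simp
  have "full_col_rank W" unfolding full_col_rank_def
  proof (intro ballI impI)
    fix u assume "u \<in> carrier_vec (dim_col W)" "W *\<^sub>v u = 0\<^sub>v (dim_row W)"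
    then have u: "u \<in> carrier_vec n" and z: "W *\<^sub>v u = 0\<^sub>v m" using W by auto
    have "u = W\<^sup>T *\<^sub>v 0\<^sub>v m" using Wte[OF u] z by simp
    also have "\<dots> = 0\<^sub>v n" using W by (intro eq_vecI) auto
    finally show "u = 0\<^sub>v (dim_col W)" using W by simp
  qed
  then obtain B where B: "mat_inverse ?T = Some B" "B \<in> carrier_mat n n" "?T * B = 1\<^sub>m n"
    using full_col_rank_square_inverse[OF T sym_pos_def_full_col_rank[OF A spd W]] by metis
  define c where "c = r \<cdot>\<^sub>v (B *\<^sub>v ?e)"
  have c: "c \<in> carrier_vec n" unfolding c_def using B by simp
  have Tc: "?T *\<^sub>v c = r \<cdot>\<^sub>v ?e"
    unfolding c_def using mult_mat_vec[OF T, of "B *\<^sub>v ?e" r] assoc_mult_mat_vec[OF T B(2), of ?e] B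
    by simp
  define x where "x = W *\<^sub>v c"
  have xc: "x \<in> carrier_vec m" unfolding x_def using W c by simp
  have Ax: "W\<^sup>T *\<^sub>v (A *\<^sub>v x) = W\<^sup>T *\<^sub>v y"
    unfolding Wty Tc[symmetric] x_def
    using A W c by (simp add: assoc_mult_mat_vec[of _ n m _ n] assoc_mult_mat_vec[of _ n m _ m])
  have swap: "(W *\<^sub>v u) \<bullet> v = (W\<^sup>T *\<^sub>v v) \<bullet> u" if "u \<in> carrier_vec n" "v \<in> carrier_vec m" for u v
    using transpose_vec_mult_scalar[OF W that] comm_scalar_prod[of "W *\<^sub>v u" m v] W that by simp
  have "galerkin A y (col_span W) x" unfolding galerkin_def
  proof (intro conjI ballI)
    show "x \<in> col_span W" unfolding x_def by (rule mult_in_col_span[OF W c])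
    fix z assume "z \<in> col_span W"
    then obtain u where "u \<in> carrier_vec n" "z = W *\<^sub>v u" using W by (rule col_spanE)
    then show "z \<bullet> (A *\<^sub>v x) = z \<bullet> y"
      using swap[of u "A *\<^sub>v x"] swap[of u y] Ax A xc yc by simp
  qed
  moreover have "y \<bullet> x = (l2_norm y)\<^sup>2 * mat_inv ?T $$ (0, 0)"
  proof -
    have "y \<bullet> x = (r \<cdot>\<^sub>v ?e) \<bullet> c"
      using swap[OF c yc] comm_scalar_prod[OF yc xc] Wty unfolding x_def by simp
    also have "\<dots> = r * r * B $$ (0, 0)"
      unfolding c_def using B(2) n by simp
    finally have yx: "y \<bullet> x = r * r * B $$ (0, 0)" .
    have "y = W *\<^sub>v (r \<cdot>\<^sub>v ?e)" using mult_mat_vec[OF W, of ?e r] y We by simp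
    then have "y \<bullet> y = (r \<cdot>\<^sub>v ?e) \<bullet> (r \<cdot>\<^sub>v ?e)"
      using swap[of "r \<cdot>\<^sub>v ?e" y] yc Wty by simp
    also have "\<dots> = r * r" using n by simp
    finally have "(l2_norm y)\<^sup>2 = r * r"
      unfolding l2_norm_def by (simp add: power2_eq_square)
    then show ?thesis using yx B(1) by simp
  qed
  ultimately show ?thesis by (rule that)
qed

lemma galerkin_whole_space:
  assumes A: "A \<in> carrier_mat m m" and spd: "sym_pos_def A" and y: "y \<in> carrier_vec m"
  shows "galerkin A y (carrier_vec m) (mat_inv A *\<^sub>v y)"
proof -
  have "full_col_rank (1\<^sub>m m)" unfolding full_col_rank_def by auto
  from sym_pos_def_full_col_rank[OF A spd one_carrier_mat this]
  have "full_col_rank A" using A by simp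
  then obtain B where B: "mat_inverse A = Some B" "B \<in> carrier_mat m m" "A * B = 1\<^sub>m m"
    using full_col_rank_square_inverse[OF A] by metis
  have "A *\<^sub>v (B *\<^sub>v y) = y" using assoc_mult_mat_vec[OF A B(2) y] B(3) y by simp
  then show ?thesis unfolding galerkin_def using B y by simp
qed

section \<open>The error bounds\<close>

theorem lemma2:
  fixes A Omega W W_hat T T_hat :: "real mat"
    and y :: "real vec"
    and m n_Omega k :: nat
  assumes "A \<in> carrier_mat m m"
    and "sym_pos_def A"
    and "y \<in> carrier_vec m"
    and "y \<noteq> 0\<^sub>v m"
    and "Omega \<in> carrier_mat m n_Omega"
    and "1 \<le> k"
    and "lin_indep_cols (krylov_matrix A (mat_of_cols m (y # cols Omega)) k)"
    and "block_lanczos_basis A (mat_of_cols m [y]) k W"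
    and "T = W\<^sup>T * A * W"
    and "block_lanczos_basis A (mat_of_cols m (y # cols Omega)) k W_hat"
    and "T_hat = W_hat\<^sup>T * A * W_hat"
  shows "0 \<le> y \<bullet> (mat_inv A *\<^sub>v y) - (l2_norm y)\<^sup>2 * mat_inv T_hat $$ (0, 0) \<and>
         y \<bullet> (mat_inv A *\<^sub>v y) - (l2_norm y)\<^sup>2 * mat_inv T_hat $$ (0, 0)
           \<le> y \<bullet> (mat_inv A *\<^sub>v y) - (l2_norm y)\<^sup>2 * mat_inv T $$ (0, 0)"
proof -
  note A = assms(1) and spd = assms(2) and y = assms(3)
  let ?Z = "mat_of_cols m (y # cols Omega)" and ?z = "mat_of_cols m [y]"
  define d where "d = Suc (dim_col Omega)"
  have Z: "?Z \<in> carrier_mat m d" using mat_of_cols_carrier(1)[of m "y # cols Omega"]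
    by (simp add: d_def)
  have z: "?z \<in> carrier_mat m 1" using mat_of_cols_carrier(1)[of m "[y]"] by simp
  have colZ: "col ?Z 0 = y" and colz: "col ?z 0 = y" using y by simp_all
  have d: "0 < d" by (simp add: d_def)
  have rkZ: "full_col_rank (krylov_matrix A ?Z k)"
    using assms(7) by (rule lin_indep_cols_imp_full_col_rank)
  have rkz: "full_col_rank (krylov_matrix A ?z k)"
    using krylov_matrix_first_column(2)[OF A y Z d colZ rkZ] .
  note LW = block_lanczos_basis_krylov[OF A z assms(8) rkz]
  note LH = block_lanczos_basis_krylov[OF A Z assms(10) rkZ]
  have W: "W \<in> carrier_mat m (k * 1)" using assms(8) z unfolding block_lanczos_basis_def by auto
  have H: "W_hat \<in> carrier_mat m (k * d)" using assms(10) Z unfolding block_lanczos_basis_def by auto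
  obtain r where r: "y = r \<cdot>\<^sub>v col W 0"
    using block_lanczos_basis_first_column[OF A z _ assms(6,8)] colz by auto
  obtain r' where r': "y = r' \<cdot>\<^sub>v col W_hat 0"
    using block_lanczos_basis_first_column[OF A Z d assms(6,10)] colZ by auto
  obtain x where x: "galerkin A y (col_span W) x" "y \<bullet> x = (l2_norm y)\<^sup>2 * mat_inv T $$ (0, 0)"
    using galerkin_orthonormal_basis[OF A spd W LW(1) _ r] assms(6,9) by auto
  obtain x' where x': "galerkin A y (col_span W_hat) x'"
    "y \<bullet> x' = (l2_norm y)\<^sup>2 * mat_inv T_hat $$ (0, 0)"
    using galerkin_orthonormal_basis[OF A spd H LH(1) _ r'] assms(6,11) d by auto
  have "col_span W \<subseteq> col_span W_hat"
    using krylov_matrix_first_column(1)[OF A y Z d colZ] LW(2) LH(2) by simp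
  moreover have Hc: "col_span W_hat \<subseteq> carrier_vec m" using col_span_carrier[OF H] by blast
  ultimately have "y \<bullet> x \<le> y \<bullet> x'" by (rule galerkin_mono[OF A spd y _ _ x(1) x'(1)])
  moreover have "y \<bullet> x' \<le> y \<bullet> (mat_inv A *\<^sub>v y)"
    by (rule galerkin_mono[OF A spd y Hc subset_refl x'(1) galerkin_whole_space[OF A spd y]])
  ultimately show ?thesis using x(2) x'(2) by simp
qed

end
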